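(* Let $P(\lambda)=\sum_{i=0}^dP_i\lambda^i\in\mathbb F[\lambda]^{n\times n}$ be a regular matrix polynomial with $d=k\ell$, for some $k$. Let $$\mathcal L(\lambda)=\left[\begin{array}{c|c}M(\lambda)&L_\eta(\lambda^\ell)^T\otimes I_n\\\hline L_\epsilon(\lambda^\ell)\otimes I_n&0\end{array}\right]$$ be an $(\epsilon,n,\eta,n)$-block Kronecker degree-$\ell$ matrix polynomial with $k=\epsilon+\eta+1$ such that $P(\lambda)=(\Lambda_\eta(\lambda^\ell)^T\otimes I_n)M(\lambda)(\Lambda_\epsilon(\lambda^\ell)\otimes I_n)$. Consider $\mathcal L(\lambda)$ partitioned into $k\times k$ blocks of size $n\times n$, any vector of size $nk\times1$ partitioned into $k\times1$ blocks of size $n\times1$, and any vector of size $1\times nk$ partitioned into $1\times k$ blocks of size $1\times n$. Then: (a1) If $z\in\mathbb F^{nk\times1}$ is a right eigenvector of $\mathcal L(\lambda)$ with finite eigenvalue $\lambda_0$, then the $(\epsilon+1)$th block of $z$ is a right eigenvector of $P(\lambda)$ with finite eigenvalue $\lambda_0$. (a2) If $z\in\mathbb F^{nk\times1}$ is a right eigenvector of $\mathcal L(\lambda)$ for the eigenvalue $\infty$, then the first block of $z$ is a right eigenvector of $P(\lambda)$ for the eigenvalue $\infty$. (b1) If $w^T\in\mathbb F^{1\times nk}$ is a left eigenvector of $\mathcal L(\lambda)$ with finite eigenvalue $\lambda_0$, then the $(\eta+1)$th block of $w^T$ is a left eigenvector of $P(\lambda)$ with finite eigenvalue $\lambda_0$.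 (b2) If $w^T\in\mathbb F^{1\times nk}$ is a left eigenvector of $\mathcal L(\lambda)$ for the eigenvalue $\infty$, then the first block of $w^T$ is a left eigenvector of $P(\lambda)$ for the eigenvalue $\infty$.
   Context: $\mathbb F$ is an arbitrary field. A matrix polynomial has grade $g$ if it can be written $\sum_{i=0}^gP_i\lambda^i$ (coefficients possibly zero); $\mathrm{rev}_gP(\lambda):=\lambda^gP(\lambda^{-1})$. A square matrix polynomial is regular if its determinant is not the zero polynomial. A right (left) eigenvector of a regular $P(\lambda)$ for a finite eigenvalue $\lambda_0$ is a nonzero $x$ with $P(\lambda_0)x=0$ (nonzero $y^T$ with $y^TP(\lambda_0)=0$). Eigenvectors for the eigenvalue $\infty$ of $P(\lambda)$ of grade $d$ are the eigenvectors of $\mathrm{rev}_dP(\lambda)$ for the eigenvalue $0$; here $P(\lambda)$ is taken with grade $d$ and $\mathcal L(\lambda)$ with grade $\ell$. $L_k(\lambda)\in\mathbb F[\lambda]^{k\times(k+1)}$ is the bidiagonal pencil with $(i,i)$ entries $-1$, $(i,i+1)$ entries $\lambda$ and other entries $0$. $\Lambda_k(\lambda)^T:=\begin{bmatrix}\lambda^k&\cdots&\lambda&1\end{bmatrix}\in\mathbb F[\lambda]^{1\times(k+1)}$. $L_k(\lambda^\ell),\Lambda_k(\lambda^\ell)$ denote these evaluated at $\lambda^\ell$. $\otimes$ is the Kronecker product. An $(\epsilon,n,\eta,m)$-block Kronecker degree-$\ell$ matrix polynomial ($\ell\ge1$, $\epsilon,\eta\ge0$ integers) is $\left[\begin{array}{c|c}M(\lambda)&L_\eta(\lambda^\ell)^T\otimes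 I_m\\\hline L_\epsilon(\lambda^\ell)\otimes I_n&0\end{array}\right]$ with $M(\lambda)$ an arbitrary $(\eta+1)m\times(\epsilon+1)n$ matrix polynomial of grade $\ell$; if $\epsilon=0$ (resp. $\eta=0$) the second block row (resp. column) is absent. *)

theory Defs
  imports "Jordan_Normal_Form.Determinant" "HOL-Computational_Algebra.Polynomial"
begin

text \<open>
  A matrix polynomial over a field is a matrix with polynomial entries, of type
  \<^typ>\<open>'a poly mat\<close>. All row, column and block indices count from 0.
\<close>

definition has_grade :: "nat \<Rightarrow> 'a::field poly mat \<Rightarrow> bool" where
  "has_grade g P \<longleftrightarrow> (\<forall>i<dim_row P. \<forall>j<dim_col P. degree (P $$ (i, j)) \<le> g)"

definition regular_mat_poly :: "'a::field poly mat \<Rightarrow> bool" where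
  "regular_mat_poly P \<longleftrightarrow> square_mat P \<and> det P \<noteq> 0"

definition eval_mat_poly :: "'a::field poly mat \<Rightarrow> 'a \<Rightarrow> 'a mat" where
  "eval_mat_poly P c = map_mat (\<lambda>p. poly p c) P"

text \<open>\<open>rev_mat_poly g P\<close> is \<open>x^g P(1/x)\<close>; this is meant for \<open>P\<close> of grade \<open>g\<close>.\<close>

definition rev_mat_poly :: "nat \<Rightarrow> 'a::field poly mat \<Rightarrow> 'a poly mat" where
  "rev_mat_poly g P = map_mat (\<lambda>p. \<Sum>i\<le>g. monom (coeff p i) (g - i)) P"

text \<open>\<open>subst_power l P\<close> is \<open>P(x^l)\<close>.\<close>

definition subst_power :: "nat \<Rightarrow> 'a::field poly mat \<Rightarrow> 'a poly mat" where
  "subst_power l P = map_mat (\<lambda>p. p \<circ>\<^sub>p monom 1 l) P"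

text \<open>
  The notions below are meant for regular \<open>P\<close>, but regularity is not one of the conjuncts:
  it is assumed or derived separately, so that statements do not presuppose it.
  The row vector \<open>y^T\<close> of a left eigenvector is represented by the vector \<open>y\<close>.
\<close>

definition right_eigenvector :: "'a::field poly mat \<Rightarrow> 'a \<Rightarrow> 'a vec \<Rightarrow> bool" where
  "right_eigenvector P c x \<longleftrightarrow>
     x \<in> carrier_vec (dim_col P) \<and> x \<noteq> 0\<^sub>v (dim_col P) \<and>
     eval_mat_poly P c *\<^sub>v x = 0\<^sub>v (dim_row P)"

definition left_eigenvector :: "'a::field poly mat \<Rightarrow> 'a \<Rightarrow> 'a vec \<Rightarrow> bool" where
  "left_eigenvector P c y \<longleftrightarrow>
     y \<in> carrier_vec (dim_row P) \<and> y \<noteq> 0\<^sub>v (dim_row P) \<and>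
     mat_of_row y * eval_mat_poly P c = 0\<^sub>m 1 (dim_col P)"

definition right_eigenvector_inf :: "nat \<Rightarrow> 'a::field poly mat \<Rightarrow> 'a vec \<Rightarrow> bool" where
  "right_eigenvector_inf g P x \<longleftrightarrow> right_eigenvector (rev_mat_poly g P) 0 x"

definition left_eigenvector_inf :: "nat \<Rightarrow> 'a::field poly mat \<Rightarrow> 'a vec \<Rightarrow> bool" where
  "left_eigenvector_inf g P y \<longleftrightarrow> left_eigenvector (rev_mat_poly g P) 0 y"

definition kronecker :: "'a::semiring_0 mat \<Rightarrow> 'a mat \<Rightarrow> 'a mat" (infixl \<open>\<otimes>\<^sub>K\<close> 70) where
  "A \<otimes>\<^sub>K B = mat (dim_row A * dim_row B) (dim_col A * dim_col B)
     (\<lambda>(i, j). A $$ (i div dim_row B, j div dim_col B) * B $$ (i mod dim_row B, j mod dim_col B))"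

definition L_pencil :: "nat \<Rightarrow> 'a::field poly mat" where
  "L_pencil k = mat k (k + 1) (\<lambda>(i, j). if j = i then - 1 else if j = i + 1 then monom 1 1 else 0)"

text \<open>The column vector with entries \<open>x^k, ..., x, 1\<close>.\<close>

definition Lambda_col :: "nat \<Rightarrow> 'a::field poly mat" where
  "Lambda_col k = mat (k + 1) 1 (\<lambda>(i, j). monom 1 (k - i))"

text \<open>
  The \<open>(eps, n, eta, m)\<close>-block Kronecker degree-\<open>l\<close> matrix polynomial with (1,1)-block \<open>M\<close>,
  which is meant to have size \<open>(eta + 1) m\<close> by \<open>(eps + 1) n\<close> and grade \<open>l\<close>. For \<open>eps = 0\<close> or
  \<open>eta = 0\<close> the second block row or block column has size 0.
\<close>

definition block_kronecker ::
  "nat \<Rightarrow> nat \<Rightarrow> nat \<Rightarrow> nat \<Rightarrow> nat \<Rightarrow> 'a::field poly mat \<Rightarrow> 'a poly mat" where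
  "block_kronecker l eps n eta m M = four_block_mat
     M (transpose_mat (subst_power l (L_pencil eta)) \<otimes>\<^sub>K 1\<^sub>m m)
     (subst_power l (L_pencil eps) \<otimes>\<^sub>K 1\<^sub>m n) (0\<^sub>m (eps * n) (eta * m))"

definition vec_block :: "nat \<Rightarrow> nat \<Rightarrow> 'a vec \<Rightarrow> 'a vec" where
  "vec_block n i z = vec n (\<lambda>j. z $ (i * n + j))"

end

theory Submission
  imports Defs
begin

text \<open>
  Evaluating \<open>\<L>\<close> at a finite point \<open>\<mu>\<close>, and evaluating its reversal at 0, give two instances of one
  constant matrix. Homogenise the pencil \<open>L_k\<close> to the bidiagonal matrix \<open>L(a, b)\<close> with \<open>-a\<close> on the
  diagonal and \<open>b\<close> above it. Then \<open>L_k(\<mu>^l) = L(1, \<mu>^l)\<close>, while the coefficient of \<open>x^l\<close> in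
  \<open>L_k(x^l)\<close> is \<open>L(0, 1)\<close>. The entries \<open>a^i b^(k-i)\<close> of the column \<open>\<Lambda>(a, b)\<close>, which is annihilated by
  \<open>L(a, b)\<close>, homogenise those of \<open>\<Lambda>_k\<close>. So both right-hand claims concern a null vector \<open>(u, v)\<close> of
    \<open>[ A, L(a,b)^T \<otimes> I; L(a,b) \<otimes> I, 0 ]\<close>.

  The second block row is a two-term recurrence on the blocks of \<open>u\<close>, whose solutions are
  \<open>u = (\<Lambda>(a,b) \<otimes> I) x\<close>; here \<open>x\<close> is the last block of \<open>u\<close> if \<open>a = 1\<close>, and the first if \<open>(a,b) = (0,1)\<close>
  (lemma \<open>hom_pencil_null_vector\<close>). Multiplying the first block row from the left by
  \<open>\<Lambda>(a,b)^T \<otimes> I\<close> removes \<open>v\<close> and leaves \<open>(\<Lambda>^T \<otimes> I) A (\<Lambda> \<otimes> I) x = 0\<close>. The vector \<open>x\<close> is nonzero: if it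
  vanished, so would \<open>u\<close>, and then the first block row says \<open>(L(a,b)^T \<otimes> I) v = 0\<close>, which forces
  \<open>v = 0\<close> (\<open>transpose_hom_pencil_injective\<close>). All this is \<open>hom_block_kronecker_null_vector\<close>.

  It remains to see that \<open>(\<Lambda>^T \<otimes> I) A (\<Lambda> \<otimes> I)\<close> is \<open>P(\<mu>)\<close> for \<open>A = M(\<mu>)\<close>, and the coefficient of \<open>x^d\<close>
  in \<open>P\<close> when \<open>A\<close> is the coefficient of \<open>x^l\<close> in \<open>M\<close>. The former holds because evaluation is
  multiplicative. For the latter, the coefficient at the grade is also multiplicative when grades
  are added up (\<open>coeff_mat_mult\<close>), and \<open>d = eta l + l + eps l\<close>. The claims on left eigenvectors
  follow by transposition, which exchanges \<open>eps\<close> and \<open>eta\<close> and stays within the family.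
\<close>

section \<open>Kronecker products with an identity matrix\<close>

lemma block_index_less:
  fixes i m n r :: nat
  assumes "i < m" "r < n"
  shows "i * n + r < m * n"
proof -
  have "i * n + r < Suc i * n" using assms by simp
  also have "\<dots> \<le> m * n" using assms by (intro mult_right_mono) auto
  finally show ?thesis .
qed

lemma kronecker_one_carrier [simp]:
  "A \<in> carrier_mat r c \<Longrightarrow> A \<otimes>\<^sub>K 1\<^sub>m n \<in> carrier_mat (r * n) (c * n)"
  by (simp add: kronecker_def)

lemma div_mod_less_block:
  fixes i m n :: nat
  assumes "i < m * n"
  shows "i div n < m" "i mod n < n"
proof -
  have "n > 0" using assms by (cases n) auto
  then show "i div n < m" "i mod n < n" using assms by (auto simp: less_mult_imp_div_less)
qed

lemma eq_vec_blockwise: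
  assumes "v \<in> carrier_vec (m * n)" "w \<in> carrier_vec (m * n)"
    and "\<And>i r. i < m \<Longrightarrow> r < n \<Longrightarrow> v $ (i * n + r) = w $ (i * n + r)"
  shows "v = w"
proof (rule eq_vecI)
  fix t assume "t < dim_vec w"
  then have t: "t < m * n" using assms(2) by simp
  show "v $ t = w $ t" using assms(3)[OF div_mod_less_block[OF t]] by simp
qed (use assms in simp)

text \<open>
  Multiplication by \<open>A \<otimes> I\<close> acts on the blocks of a vector as \<open>A\<close> acts on scalars. This formula
  replaces the mixed-product rule for Kronecker products everywhere below.
\<close>

lemma kronecker_one_mult_vec:
  fixes A :: "'a::comm_semiring_1 mat"
  assumes A: "A \<in> carrier_mat m c" and v: "v \<in> carrier_vec (c * n)" and i: "i < m" and r: "r < n"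
  shows "((A \<otimes>\<^sub>K 1\<^sub>m n) *\<^sub>v v) $ (i * n + r) = (\<Sum>j<c. A $$ (i, j) * v $ (j * n + r))"
proof -
  let ?f = "\<lambda>t. (A \<otimes>\<^sub>K 1\<^sub>m n) $$ (i * n + r, t) * v $ t"
  have ir: "i * n + r < m * n" using i r by (rule block_index_less)
  have "((A \<otimes>\<^sub>K 1\<^sub>m n) *\<^sub>v v) $ (i * n + r) = sum ?f {..<c * n}"
    using A v ir by (simp add: scalar_prod_def kronecker_def atLeast0LessThan)
  also have "\<dots> = (\<Sum>j<c. sum ?f {j * n..<j * n + n})"
    by (simp add: sum.nat_group)
  also have "\<dots> = (\<Sum>j<c. A $$ (i, j) * v $ (j * n + r))"
  proof (rule sum.cong[OF refl])
    fix j assume "j \<in> {..<c}"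
    then have j: "j < c" by simp
    have "sum ?f {j * n..<j * n + n} = (\<Sum>s<n. ?f (j * n + s))"
      by (rule sum.reindex_bij_witness[of _ "\<lambda>s. j * n + s" "\<lambda>t. t - j * n"]) auto
    also have "\<dots> = (\<Sum>s<n. if s = r then A $$ (i, j) * v $ (j * n + r) else 0)"
    proof (rule sum.cong[OF refl])
      fix s assume "s \<in> {..<n}"
      then have s: "s < n" by simp
      show "?f (j * n + s) = (if s = r then A $$ (i, j) * v $ (j * n + r) else 0)"
        using A ir block_index_less[OF j s] r s by (simp add: kronecker_def)
    qed
    also have "\<dots> = A $$ (i, j) * v $ (j * n + r)" using r by simp
    finally show "sum ?f {j * n..<j * n + n} = A $$ (i, j) * v $ (j * n + r)" .
  qed
  finally show ?thesis .
qed

lemma map_mat_kronecker_one: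
  assumes "f 0 = (0::'b::semiring_1)"
  shows "map_mat f ((A::'a::semiring_1 mat) \<otimes>\<^sub>K 1\<^sub>m n) = map_mat f A \<otimes>\<^sub>K 1\<^sub>m n"
  using assms div_mod_less_block by (intro eq_matI) (auto simp: kronecker_def)

lemma map_mat_zero: "f 0 = 0 \<Longrightarrow> map_mat f (0\<^sub>m r c) = 0\<^sub>m r c"
  by (intro eq_matI) auto

lemma map_mat_transpose: "map_mat f (transpose_mat A) = transpose_mat (map_mat f A)"
  by (intro eq_matI) auto

lemma transpose_kronecker_one:
  fixes A :: "'a::semiring_1 mat"
  shows "transpose_mat (A \<otimes>\<^sub>K 1\<^sub>m n) = transpose_mat A \<otimes>\<^sub>K 1\<^sub>m n"
  using div_mod_less_block by (intro eq_matI) (auto simp: kronecker_def)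

section \<open>Null vectors of homogeneous block Kronecker matrices\<close>

text \<open>
  Finite eigenvalues correspond to the points \<open>(a, b) = (1, \<mu>^l)\<close>, the infinite one to \<open>(0, 1)\<close>.
\<close>

definition hom_pencil :: "'a::field \<Rightarrow> 'a \<Rightarrow> nat \<Rightarrow> 'a mat" where
  "hom_pencil a b k = mat k (k + 1) (\<lambda>(i, j). if j = i then - a else if j = i + 1 then b else 0)"

definition hom_Lambda :: "'a::field \<Rightarrow> 'a \<Rightarrow> nat \<Rightarrow> 'a mat" where
  "hom_Lambda a b k = mat (k + 1) 1 (\<lambda>(i, j). a ^ i * b ^ (k - i))"

lemma hom_pencil_carrier [simp]: "hom_pencil a b k \<in> carrier_mat k (Suc k)"
  by (simp add: hom_pencil_def)

lemma hom_Lambda_carrier [simp]: "hom_Lambda a b k \<in> carrier_mat (Suc k) (Suc 0)"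
  by (simp add: hom_Lambda_def)

lemma sum_hom_pencil_row:
  assumes "i < k"
  shows "(\<Sum>j<k+1. hom_pencil a b k $$ (i, j) * f j) = b * f (i + 1) - a * f i"
proof -
  have "(\<Sum>j<k+1. hom_pencil a b k $$ (i, j) * f j) = (\<Sum>j\<in>{i, i + 1}. hom_pencil a b k $$ (i, j) * f j)"
    using assms by (intro sum.mono_neutral_right) (auto simp: hom_pencil_def)
  also have "\<dots> = b * f (i + 1) - a * f i"
    using assms by (simp add: hom_pencil_def)
  finally show ?thesis .
qed

lemma hom_pencil_mult_Lambda: "hom_pencil a b k * hom_Lambda a b k = 0\<^sub>m k 1"
proof (rule eq_matI)
  fix i j assume "i < dim_row (0\<^sub>m k 1 :: 'a mat)" "j < dim_col (0\<^sub>m k 1 :: 'a mat)"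
  then have i: "i < k" and j: "j = 0" by auto
  have "(hom_pencil a b k * hom_Lambda a b k) $$ (i, j)
      = (\<Sum>t<k+1. hom_pencil a b k $$ (i, t) * (a ^ t * b ^ (k - t)))"
    using i j by (simp add: scalar_prod_def hom_pencil_def hom_Lambda_def atLeast0LessThan del: sum.lessThan_Suc)
  also have "\<dots> = b * (a ^ (i + 1) * b ^ (k - (i + 1))) - a * (a ^ i * b ^ (k - i))"
    by (rule sum_hom_pencil_row[OF i])
  also have "k - i = Suc (k - (i + 1))" using i by simp
  finally show "(hom_pencil a b k * hom_Lambda a b k) $$ (i, j) = 0\<^sub>m k 1 $$ (i, j)"
    using i j by simp
qed (simp_all add: hom_pencil_def hom_Lambda_def)

text \<open>
  This is \<open>L(a,b) \<Lambda>(a,b) = 0\<close> transposed and tensored with the identity. It eliminates the second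
  part of a null vector from the first block row.
\<close>

lemma Lambda_annihilates:
  assumes v: "v \<in> carrier_vec (k * n)"
  shows "(transpose_mat (hom_Lambda a b k) \<otimes>\<^sub>K 1\<^sub>m n)
      *\<^sub>v ((transpose_mat (hom_pencil a b k) \<otimes>\<^sub>K 1\<^sub>m n) *\<^sub>v v) = 0\<^sub>v (1 * n)"
proof -
  let ?L = "hom_pencil a b k" and ?\<Lambda> = "hom_Lambda a b k"
  let ?w = "(transpose_mat ?L \<otimes>\<^sub>K 1\<^sub>m n) *\<^sub>v v"
  have LT: "transpose_mat ?L \<in> carrier_mat (k + 1) k" 
    and \<Lambda>T: "transpose_mat ?\<Lambda> \<in> carrier_mat 1 (k + 1)" by simp_all
  have w: "?w \<in> carrier_vec ((k + 1) * n)"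
    using kronecker_one_carrier[OF LT] v by (rule mult_mat_vec_carrier)
  show ?thesis
  proof (rule eq_vec_blockwise[of _ 1 n])
    show "(transpose_mat ?\<Lambda> \<otimes>\<^sub>K 1\<^sub>m n) *\<^sub>v ?w \<in> carrier_vec (1 * n)"
      using kronecker_one_carrier[OF \<Lambda>T] w by (rule mult_mat_vec_carrier)
    fix i r :: nat assume i: "i < 1" and r: "r < n"
    have "((transpose_mat ?\<Lambda> \<otimes>\<^sub>K 1\<^sub>m n) *\<^sub>v ?w) $ (i * n + r)
        = (\<Sum>t<k+1. transpose_mat ?\<Lambda> $$ (i, t) * ?w $ (t * n + r))"
      by (rule kronecker_one_mult_vec[OF \<Lambda>T w i r])
    also have "\<dots> = (\<Sum>t<k+1. \<Sum>j<k. ?\<Lambda> $$ (t, 0) * (?L $$ (j, t) * v $ (j * n + r)))"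
    proof (rule sum.cong[OF refl])
      fix t assume "t \<in> {..<k+1}"
      then have t: "t < k + 1" by simp
      have "?w $ (t * n + r) = (\<Sum>j<k. ?L $$ (j, t) * v $ (j * n + r))"
        using kronecker_one_mult_vec[OF LT v t r] t by (simp add: hom_pencil_def)
      then show "transpose_mat ?\<Lambda> $$ (i, t) * ?w $ (t * n + r)
          = (\<Sum>j<k. ?\<Lambda> $$ (t, 0) * (?L $$ (j, t) * v $ (j * n + r)))"
        using i t by (simp add: sum_distrib_left hom_Lambda_def)
    qed
    also have "\<dots> = (\<Sum>j<k. \<Sum>t<k+1. ?\<Lambda> $$ (t, 0) * (?L $$ (j, t) * v $ (j * n + r)))"
      by (rule sum.swap)
    also have "\<dots> = (\<Sum>j<k. (?L * ?\<Lambda>) $$ (j, 0) * v $ (j * n + r))"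
    proof (rule sum.cong[OF refl])
      fix j assume "j \<in> {..<k}"
      then have "(?L * ?\<Lambda>) $$ (j, 0) = (\<Sum>t<k+1. ?L $$ (j, t) * ?\<Lambda> $$ (t, 0))"
        by (simp add: scalar_prod_def hom_pencil_def hom_Lambda_def atLeast0LessThan del: sum.lessThan_Suc)
      then show "(\<Sum>t<k+1. ?\<Lambda> $$ (t, 0) * (?L $$ (j, t) * v $ (j * n + r)))
          = (?L * ?\<Lambda>) $$ (j, 0) * v $ (j * n + r)"
        by (simp only: sum_distrib_right) (simp only: mult_ac)
    qed
    also have "\<dots> = 0" by (simp add: hom_pencil_mult_Lambda)
    finally show "((transpose_mat ?\<Lambda> \<otimes>\<^sub>K 1\<^sub>m n) *\<^sub>v ?w) $ (i * n + r) = 0\<^sub>v (1 * n) $ (i * n + r)"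
      using block_index_less[OF i r] by simp
  qed simp
qed

text \<open>
  The first block equation determines the first block of \<open>v\<close> and the others propagate along the
  diagonal if \<open>a \<noteq> 0\<close>; if \<open>a = 0\<close>, each block except the first in turn reads off one block of \<open>v\<close>
  times \<open>b\<close>.
\<close>

lemma transpose_hom_pencil_injective:
  assumes v: "v \<in> carrier_vec (k * n)" and ab: "a \<noteq> 0 \<or> b \<noteq> 0"
    and 0: "(transpose_mat (hom_pencil a b k) \<otimes>\<^sub>K 1\<^sub>m n) *\<^sub>v v = 0\<^sub>v ((k + 1) * n)"
  shows "v = 0\<^sub>v (k * n)"
proof -
  have LT: "transpose_mat (hom_pencil a b k) \<in> carrier_mat (k + 1) k" by simp
  have eq: "(\<Sum>j<k. hom_pencil a b k $$ (j, i) * v $ (j * n + r)) = 0" if i: "i < k + 1" and r: "r < n" for i r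
    using kronecker_one_mult_vec[OF LT v i r] i block_index_less[OF i r] unfolding 0
    by (simp add: hom_pencil_def)
  have step: "a * v $ (i * n + r) = b * v $ ((i - 1) * n + r)" if "0 < i" "i < k" "r < n" for i r
  proof -
    have "(\<Sum>j<k. hom_pencil a b k $$ (j, i) * v $ (j * n + r))
        = (\<Sum>j\<in>{i - 1, i}. hom_pencil a b k $$ (j, i) * v $ (j * n + r))"
      using that by (intro sum.mono_neutral_right) (auto simp: hom_pencil_def)
    also have "\<dots> = b * v $ ((i - 1) * n + r) - a * v $ (i * n + r)"
      using that by (cases i) (simp_all add: hom_pencil_def)
    finally show ?thesis using eq[of i r] that by simp
  qed
  have first: "a * v $ (0 * n + r) = 0" if "0 < k" "r < n" for r
  proof -
    have "(\<Sum>j<k. hom_pencil a b k $$ (j, 0) * v $ (j * n + r))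
        = (\<Sum>j\<in>{0}. hom_pencil a b k $$ (j, 0) * v $ (j * n + r))"
      using that by (intro sum.mono_neutral_right) (auto simp: hom_pencil_def)
    then show ?thesis using eq[of 0 r] that by (simp add: hom_pencil_def)
  qed
  have last: "b * v $ ((k - 1) * n + r) = 0" if "0 < k" "r < n" for r
  proof -
    have "(\<Sum>j<k. hom_pencil a b k $$ (j, k) * v $ (j * n + r))
        = (\<Sum>j\<in>{k - 1}. hom_pencil a b k $$ (j, k) * v $ (j * n + r))"
      using that by (intro sum.mono_neutral_right) (auto simp: hom_pencil_def)
    also have "\<dots> = b * v $ ((k - 1) * n + r)"
      using that by (cases k) (simp_all add: hom_pencil_def)
    finally show ?thesis using eq[of k r] that by simp
  qed
  have "v $ (i * n + r) = 0" if i: "i < k" and r: "r < n" for i r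
  proof (cases "a = 0")
    case True
    then show ?thesis using ab step[of "Suc i" r] last[of r] i r
      by (cases "Suc i < k") (auto simp: not_less less_eq_Suc_le[symmetric] dest: le_antisym)
  next
    case False
    from i show ?thesis
    proof (induction i)
      case 0
      then show ?case using first[of r] r False by simp
    next
      case (Suc i)
      then show ?case using step[of "Suc i" r] r False by simp
    qed
  qed
  then show ?thesis
    using v block_index_less by (intro eq_vec_blockwise[of _ k n]) auto
qed

text \<open>
  Consecutive blocks satisfy \<open>b u(i+1) = a u(i)\<close>. If \<open>a = 1\<close>, all blocks are obtained from the last
  one by descending; if \<open>a = 0\<close> and \<open>b = 1\<close>, all blocks but the first vanish. The index \<open>p\<close> of the free
  block is a position where \<open>\<Lambda>(a,b)\<close> has entry 1, thanks to \<open>0^0 = 1\<close>.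
\<close>

lemma hom_pencil_null_vector:
  assumes u: "u \<in> carrier_vec ((k + 1) * n)"
    and 0: "(hom_pencil a b k \<otimes>\<^sub>K 1\<^sub>m n) *\<^sub>v u = 0\<^sub>v (k * n)"
    and p: "a = 1 \<and> p = k \<or> a = 0 \<and> b = 1 \<and> p = 0"
  shows "u = (hom_Lambda a b k \<otimes>\<^sub>K 1\<^sub>m n) *\<^sub>v vec_block n p u"
proof -
  have L: "hom_pencil a b k \<in> carrier_mat k (k + 1)" 
    and \<Lambda>: "hom_Lambda a b k \<in> carrier_mat (k + 1) 1" by simp_all
  have x: "vec_block n p u \<in> carrier_vec (1 * n)" by (simp add: vec_block_def)
  have block_step: "b * u $ ((i + 1) * n + r) = a * u $ (i * n + r)" if i: "i < k" and r: "r < n" for i r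
    using kronecker_one_mult_vec[OF L u i r] block_index_less[OF i r]
    unfolding 0 sum_hom_pencil_row[OF i] by simp
  have blocks: "u $ (i * n + r) = a ^ i * b ^ (k - i) * u $ (p * n + r)" if i: "i \<le> k" and r: "r < n" for i r
    using p
  proof
    assume ap: "a = 1 \<and> p = k"
    have "u $ (i * n + r) = b ^ (k - i) * u $ (k * n + r)"
      using i
    proof (induction rule: inc_induct)
      case (step i)
      then show ?case
        using block_step[of i r] r ap
        by (simp add: Suc_diff_Suc[symmetric] mult.assoc)
    qed simp
    then show ?thesis using ap by simp
  next
    assume "a = 0 \<and> b = 1 \<and> p = 0"
    then show ?thesis using block_step[of "i - 1" r] i r by (cases i) auto
  qed
  show ?thesis
  proof (rule eq_vec_blockwise[OF u])
    show "(hom_Lambda a b k \<otimes>\<^sub>K 1\<^sub>m n) *\<^sub>v vec_block n p u \<in> carrier_vec ((k + 1) * n)"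
      using kronecker_one_carrier[OF \<Lambda>] x by (rule mult_mat_vec_carrier)
    fix i r assume i: "i < k + 1" and r: "r < n"
    show "u $ (i * n + r) = ((hom_Lambda a b k \<otimes>\<^sub>K 1\<^sub>m n) *\<^sub>v vec_block n p u) $ (i * n + r)"
      using kronecker_one_mult_vec[OF \<Lambda> x i r] blocks[of i r] i r
      by (simp add: hom_Lambda_def vec_block_def)
  qed
qed

text \<open>
  The common core of the finite and the infinite case. For \<open>a = 0\<close>, \<open>b = 1\<close> the product in the
  second conclusion is just the upper left \<open>n\<close> by \<open>n\<close> block of \<open>A\<close>.
\<close>

lemma hom_block_kronecker_null_vector:
  fixes A :: "'a::field mat"
  assumes A: "A \<in> carrier_mat ((eta + 1) * n) ((eps + 1) * n)"
    and z: "z \<in> carrier_vec ((eps + 1) * n + eta * n)" "z \<noteq> 0\<^sub>v ((eps + 1) * n + eta * n)"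
    and 0: "four_block_mat A (transpose_mat (hom_pencil a b eta) \<otimes>\<^sub>K 1\<^sub>m n)
         (hom_pencil a b eps \<otimes>\<^sub>K 1\<^sub>m n) (0\<^sub>m (eps * n) (eta * n)) *\<^sub>v z
       = 0\<^sub>v ((eta + 1) * n + eps * n)"
    and p: "a = 1 \<and> p = eps \<or> a = 0 \<and> b = 1 \<and> p = 0"
  shows "vec_block n p z \<noteq> 0\<^sub>v n"
    and "(transpose_mat (hom_Lambda a b eta) \<otimes>\<^sub>K 1\<^sub>m n) * A * (hom_Lambda a b eps \<otimes>\<^sub>K 1\<^sub>m n)
       *\<^sub>v vec_block n p z = 0\<^sub>v n"
proof -
  let ?u = "vec_first z ((eps + 1) * n)" and ?v = "vec_last z (eta * n)"
  let ?x = "vec_block n p z"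
  let ?B = "transpose_mat (hom_pencil a b eta) \<otimes>\<^sub>K 1\<^sub>m n" and ?C = "hom_pencil a b eps \<otimes>\<^sub>K 1\<^sub>m n"
  let ?\<Lambda>1 = "transpose_mat (hom_Lambda a b eta) \<otimes>\<^sub>K 1\<^sub>m n" and ?\<Lambda>2 = "hom_Lambda a b eps \<otimes>\<^sub>K 1\<^sub>m n"
  have B: "?B \<in> carrier_mat ((eta + 1) * n) (eta * n)"
    and C: "?C \<in> carrier_mat (eps * n) ((eps + 1) * n)"
    and \<Lambda>1: "?\<Lambda>1 \<in> carrier_mat (1 * n) ((eta + 1) * n)"
    and \<Lambda>2: "?\<Lambda>2 \<in> carrier_mat ((eps + 1) * n) (1 * n)"
    by (rule kronecker_one_carrier, simp)+
  have u: "?u \<in> carrier_vec ((eps + 1) * n)" and v: "?v \<in> carrier_vec (eta * n)"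
    and x: "?x \<in> carrier_vec (1 * n)" by (simp_all add: vec_block_def)
  have zuv: "?u @\<^sub>v ?v = z" using z(1) by simp
  have Bv: "?B *\<^sub>v ?v \<in> carrier_vec ((eta + 1) * n)" using B v by (rule mult_mat_vec_carrier)
  have Au: "A *\<^sub>v ?u \<in> carrier_vec ((eta + 1) * n)" using A u by (rule mult_mat_vec_carrier)
  have Cu: "?C *\<^sub>v ?u \<in> carrier_vec (eps * n)" using C u by (rule mult_mat_vec_carrier)
  have "(A *\<^sub>v ?u + ?B *\<^sub>v ?v) @\<^sub>v (?C *\<^sub>v ?u + 0\<^sub>m (eps * n) (eta * n) *\<^sub>v ?v)
      = 0\<^sub>v ((eta + 1) * n) @\<^sub>v 0\<^sub>v (eps * n)"
    using 0 four_block_mat_mult_vec[OF A B C zero_carrier_mat u v] unfolding zuv by auto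
  moreover have "0\<^sub>m (eps * n) (eta * n) *\<^sub>v ?v = 0\<^sub>v (eps * n)" using v by auto
  ultimately have top: "A *\<^sub>v ?u + ?B *\<^sub>v ?v = 0\<^sub>v ((eta + 1) * n)" and bot: "?C *\<^sub>v ?u = 0\<^sub>v (eps * n)"
    using Au Bv Cu by (auto simp: append_vec_eq[of _ "(eta + 1) * n"])
  \<comment> \<open>The free block lies in the first part of \<open>z\<close>.\<close>
  have "vec_block n p ?u = ?x"
  proof
    fix r assume "r < dim_vec ?x"
    then have "r < n" by (simp add: vec_block_def)
    moreover have "p < eps + 1" using p by auto
    ultimately show "vec_block n p ?u $ r = ?x $ r"
      using block_index_less[of p "eps + 1" r n] by (simp add: vec_block_def vec_first_def)
  qed (simp add: vec_block_def)
  then have u_eq: "?u = ?\<Lambda>2 *\<^sub>v ?x" using hom_pencil_null_vector[OF u bot p] by simp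
  \<comment> \<open>Compress the first block row from the left; the contribution of \<open>?v\<close> disappears.\<close>
  have "0\<^sub>v (1 * n) = ?\<Lambda>1 *\<^sub>v (A *\<^sub>v ?u + ?B *\<^sub>v ?v)"
    unfolding top using \<Lambda>1 by auto
  also have "\<dots> = ?\<Lambda>1 *\<^sub>v (A *\<^sub>v ?u) + ?\<Lambda>1 *\<^sub>v (?B *\<^sub>v ?v)"
    by (rule mult_add_distrib_mat_vec[OF \<Lambda>1 Au Bv])
  also have "\<dots> = ?\<Lambda>1 *\<^sub>v (A *\<^sub>v ?u)"
    unfolding Lambda_annihilates[OF v] using mult_mat_vec_carrier[OF \<Lambda>1 Au] by (rule right_zero_vec)
  also have "\<dots> = ?\<Lambda>1 * A *\<^sub>v ?u" by (rule assoc_mult_mat_vec[OF \<Lambda>1 A u, symmetric])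
  also have "\<dots> = ?\<Lambda>1 * A *\<^sub>v (?\<Lambda>2 *\<^sub>v ?x)" using u_eq by simp
  also have "\<dots> = ?\<Lambda>1 * A * ?\<Lambda>2 *\<^sub>v ?x"
    by (rule assoc_mult_mat_vec[OF mult_carrier_mat[OF \<Lambda>1 A] \<Lambda>2 x, symmetric])
  finally show "?\<Lambda>1 * A * ?\<Lambda>2 *\<^sub>v ?x = 0\<^sub>v n" by simp
  show "?x \<noteq> 0\<^sub>v n"
  proof
    assume "?x = 0\<^sub>v n"
    then have u0: "?u = 0\<^sub>v ((eps + 1) * n)" using u_eq \<Lambda>2 by auto
    then have "A *\<^sub>v ?u = 0\<^sub>v ((eta + 1) * n)" using A by auto
    then have "?B *\<^sub>v ?v = 0\<^sub>v ((eta + 1) * n)" using top Bv by simp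
    then have "?v = 0\<^sub>v (eta * n)" using p by (intro transpose_hom_pencil_injective[OF v]) auto
    then have "z = 0\<^sub>v ((eps + 1) * n) @\<^sub>v 0\<^sub>v (eta * n)" using u0 zuv by simp
    then show False using z(2) by auto
  qed
qed

section \<open>Values and leading coefficients of matrix polynomials\<close>

definition coeff_mat :: "nat \<Rightarrow> 'a::field poly mat \<Rightarrow> 'a mat" where
  "coeff_mat g P = map_mat (\<lambda>p. coeff p g) P"

text \<open>
  Eigenvectors at infinity are thus null vectors of the coefficient at the grade, and reversals need
  not be multiplied out.
\<close>

lemma eval_rev_mat_poly_0: "eval_mat_poly (rev_mat_poly g P) 0 = coeff_mat g P"
proof -
  have "poly (\<Sum>i\<le>g. monom (coeff p i) (g - i)) 0 = coeff p g" for p :: "'a poly"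
  proof -
    have "poly (\<Sum>i\<le>g. monom (coeff p i) (g - i)) 0 = (\<Sum>i\<le>g. if i = g then coeff p g else 0)"
      unfolding poly_sum by (intro sum.cong) (auto simp: poly_monom)
    then show ?thesis by simp
  qed
  then show ?thesis
    by (intro eq_matI) (auto simp: eval_mat_poly_def rev_mat_poly_def coeff_mat_def)
qed

lemma coeff_mult_grade:
  fixes p q :: "'a::field poly"
  assumes "degree p \<le> g" "degree q \<le> h"
  shows "coeff (p * q) (g + h) = coeff p g * coeff q h"
proof (cases "degree p = g \<and> degree q = h")
  case True
  then show ?thesis using coeff_mult_degree_sum[of p q] by simp
next
  case False
  then have "degree p < g \<or> degree q < h" using assms by auto
  moreover from this have "degree (p * q) < g + h"
    using degree_mult_le[of p q] assms by linarith
  ultimately show ?thesis by (auto simp: coeff_eq_0)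
qed

lemma index_mult_mat_sum:
  assumes "A \<in> carrier_mat m c" "B \<in> carrier_mat c q" "i < m" "j < q"
  shows "(A * B) $$ (i, j) = (\<Sum>t<c. A $$ (i, t) * B $$ (t, j))"
  using assms by (auto simp: scalar_prod_def atLeast0LessThan)

lemma has_grade_mult:
  assumes "A \<in> carrier_mat m c" "B \<in> carrier_mat c q" "has_grade g A" "has_grade h B"
  shows "has_grade (g + h) (A * B)"
proof -
  have "degree (\<Sum>t<c. A $$ (i, t) * B $$ (t, j)) \<le> g + h" if "i < m" "j < q" for i j
    using that assms
    by (intro degree_sum_le order.trans[OF degree_mult_le] add_mono) (auto simp: has_grade_def)
  then show ?thesis
    using assms(1,2) index_mult_mat_sum[OF assms(1,2)] unfolding has_grade_def
    by (simp del: index_mult_mat(1))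
qed

text \<open>
  Only the top terms of two matrix polynomials of grades \<open>g\<close> and \<open>h\<close> contribute to degree \<open>g + h\<close> of
  the product, so the coefficient at the grade behaves like an evaluation at infinity.
\<close>

lemma coeff_mat_mult:
  assumes AB: "A \<in> carrier_mat m c" "B \<in> carrier_mat c q" and gr: "has_grade g A" "has_grade h B"
  shows "coeff_mat (g + h) (A * B) = coeff_mat g A * coeff_mat h B"
proof (rule eq_matI)
  fix i j assume "i < dim_row (coeff_mat g A * coeff_mat h B)" "j < dim_col (coeff_mat g A * coeff_mat h B)"
  then have ij: "i < m" "j < q" using AB by (auto simp: coeff_mat_def)
  have "coeff ((A * B) $$ (i, j)) (g + h) = (\<Sum>t<c. coeff (A $$ (i, t) * B $$ (t, j)) (g + h))"
    by (simp add: index_mult_mat_sum[OF AB ij] coeff_sum)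
  also have "\<dots> = (\<Sum>t<c. coeff (A $$ (i, t)) g * coeff (B $$ (t, j)) h)"
    using gr AB ij by (intro sum.cong[OF refl] coeff_mult_grade) (auto simp: has_grade_def)
  finally show "coeff_mat (g + h) (A * B) $$ (i, j) = (coeff_mat g A * coeff_mat h B) $$ (i, j)"
    using AB ij by (simp add: coeff_mat_def scalar_prod_def atLeast0LessThan)
qed (use AB in \<open>auto simp: coeff_mat_def\<close>)

lemma eval_mat_poly_mult:
  assumes AB: "A \<in> carrier_mat m c" "B \<in> carrier_mat c q"
  shows "eval_mat_poly (A * B) \<mu> = eval_mat_poly A \<mu> * eval_mat_poly B \<mu>"
proof (rule eq_matI)
  fix i j assume "i < dim_row (eval_mat_poly A \<mu> * eval_mat_poly B \<mu>)"
    "j < dim_col (eval_mat_poly A \<mu> * eval_mat_poly B \<mu>)"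
  then have ij: "i < m" "j < q" using AB by (auto simp: eval_mat_poly_def)
  have "poly ((A * B) $$ (i, j)) \<mu> = (\<Sum>t<c. poly (A $$ (i, t)) \<mu> * poly (B $$ (t, j)) \<mu>)"
    by (simp add: index_mult_mat_sum[OF AB ij] poly_sum)
  then show "eval_mat_poly (A * B) \<mu> $$ (i, j) = (eval_mat_poly A \<mu> * eval_mat_poly B \<mu>) $$ (i, j)"
    using AB ij by (simp add: eval_mat_poly_def scalar_prod_def atLeast0LessThan)
qed (use AB in \<open>auto simp: eval_mat_poly_def\<close>)

lemma pcompose_monom_monom:
  "monom (1::'a::field) i \<circ>\<^sub>p monom 1 l = monom 1 (i * l)"
proof (induction i)
  case 0
  then show ?case by (simp add: monom_0 pcompose_const pcompose_1)
next
  case (Suc i)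
  then show ?case by (simp add: monom_Suc pcompose_pCons mult_monom)
qed

lemma subst_power_carrier [simp]: "A \<in> carrier_mat m c \<Longrightarrow> subst_power l A \<in> carrier_mat m c"
  by (simp add: subst_power_def)

lemma L_pencil_carrier [simp]: "L_pencil k \<in> carrier_mat k (Suc k)"
  by (simp add: L_pencil_def)

lemma Lambda_col_carrier [simp]: "Lambda_col k \<in> carrier_mat (Suc k) (Suc 0)"
  by (simp add: Lambda_col_def)

lemma subst_power_L_pencil:
  "subst_power l (L_pencil k)
    = mat k (k + 1) (\<lambda>(i, j). if j = i then - 1 else if j = i + 1 then monom 1 l else 0)"
  using pcompose_monom_monom[of 1 l]
  by (intro eq_matI) (auto simp: subst_power_def L_pencil_def pcompose_uminus pcompose_1)

lemma subst_power_Lambda_col: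
  "subst_power l (Lambda_col k) = mat (k + 1) 1 (\<lambda>(i, j). monom 1 ((k - i) * l))"
  by (intro eq_matI) (auto simp: subst_power_def Lambda_col_def pcompose_monom_monom)

lemma eval_subst_power_L_pencil:
  "map_mat (\<lambda>p. poly p \<mu>) (subst_power l (L_pencil k)) = hom_pencil 1 (\<mu> ^ l) k"
  by (intro eq_matI) (auto simp: subst_power_L_pencil hom_pencil_def poly_monom)

text \<open>Positivity of \<open>l\<close> keeps the constant entries \<open>-1\<close> out of the coefficient of \<open>x^l\<close>.\<close>

lemma coeff_subst_power_L_pencil:
  "l \<ge> 1 \<Longrightarrow> map_mat (\<lambda>p. coeff p l) (subst_power l (L_pencil k)) = hom_pencil 0 1 k"
  by (intro eq_matI) (auto simp: subst_power_L_pencil hom_pencil_def)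

lemma eval_subst_power_Lambda_col:
  "map_mat (\<lambda>p. poly p \<mu>) (subst_power l (Lambda_col k)) = hom_Lambda 1 (\<mu> ^ l) k"
  by (intro eq_matI) (auto simp: subst_power_Lambda_col hom_Lambda_def poly_monom power_mult[symmetric] mult.commute)

lemma coeff_subst_power_Lambda_col:
  "l \<ge> 1 \<Longrightarrow> map_mat (\<lambda>p. coeff p (k * l)) (subst_power l (Lambda_col k)) = hom_Lambda 0 1 k"
  by (intro eq_matI) (auto simp: subst_power_Lambda_col hom_Lambda_def power_0_left)

lemma has_grade_kronecker_one:
  assumes "has_grade g A"
  shows "has_grade g (A \<otimes>\<^sub>K 1\<^sub>m n)"
  using assms div_mod_less_block by (auto simp: has_grade_def kronecker_def)

lemma has_grade_transpose [simp]: "has_grade g (transpose_mat A) \<longleftrightarrow> has_grade g A"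
  by (auto simp: has_grade_def)

lemma has_grade_Lambda_col: "has_grade (k * l) (subst_power l (Lambda_col k))"
  by (auto simp: has_grade_def subst_power_Lambda_col degree_monom_eq)

lemma block_kronecker_carrier:
  assumes "M \<in> carrier_mat ((eta + 1) * m) ((eps + 1) * n)"
  shows "block_kronecker l eps n eta m M
    \<in> carrier_mat ((eta + 1) * m + eps * n) ((eps + 1) * n + eta * m)"
  unfolding block_kronecker_def using assms by (intro four_block_carrier_mat zero_carrier_mat)

text \<open>
  Stated for any entrywise map fixing 0, so that it covers both evaluation and extraction of a
  coefficient, although the latter is not a ring homomorphism.
\<close>

lemma map_block_kronecker:
  fixes f :: "'a::field poly \<Rightarrow> 'b::semiring_1"
  assumes M: "M \<in> carrier_mat ((eta + 1) * m) ((eps + 1) * n)" and "f 0 = 0"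
  shows "map_mat f (block_kronecker l eps n eta m M) = four_block_mat
     (map_mat f M) (transpose_mat (map_mat f (subst_power l (L_pencil eta))) \<otimes>\<^sub>K 1\<^sub>m m)
     (map_mat f (subst_power l (L_pencil eps)) \<otimes>\<^sub>K 1\<^sub>m n) (0\<^sub>m (eps * n) (eta * m))"
proof -
  have blocks: "transpose_mat (subst_power l (L_pencil eta)) \<otimes>\<^sub>K 1\<^sub>m m \<in> carrier_mat ((eta + 1) * m) (eta * m)"
    "subst_power l (L_pencil eps) \<otimes>\<^sub>K 1\<^sub>m n \<in> carrier_mat (eps * n) ((eps + 1) * n)"
    by (rule kronecker_one_carrier, simp)+
  show ?thesis
    unfolding block_kronecker_def map_four_block_mat[OF M blocks zero_carrier_mat]
    using \<open>f 0 = 0\<close>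
    by (simp add: map_mat_kronecker_one map_mat_transpose map_mat_zero)
qed

section \<open>Recovery of right eigenvectors\<close>

lemma recover_right_eigenvector:
  assumes M: "M \<in> carrier_mat ((eta + 1) * n) ((eps + 1) * n)"
    and P: "P = (transpose_mat (subst_power l (Lambda_col eta)) \<otimes>\<^sub>K 1\<^sub>m n) * M
             * (subst_power l (Lambda_col eps) \<otimes>\<^sub>K 1\<^sub>m n)"
    and z: "right_eigenvector (block_kronecker l eps n eta n M) \<mu> z"
  shows "right_eigenvector P \<mu> (vec_block n eps z)"
proof -
  let ?\<Lambda>1 = "transpose_mat (subst_power l (Lambda_col eta)) \<otimes>\<^sub>K 1\<^sub>m n"
  let ?\<Lambda>2 = "subst_power l (Lambda_col eps) \<otimes>\<^sub>K 1\<^sub>m n"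
  let ?E = "map_mat (\<lambda>p. poly p \<mu>)"
  have \<Lambda>1: "?\<Lambda>1 \<in> carrier_mat (1 * n) ((eta + 1) * n)"
    and \<Lambda>2: "?\<Lambda>2 \<in> carrier_mat ((eps + 1) * n) (1 * n)"
    by (rule kronecker_one_carrier, simp)+
  note dims = block_kronecker_carrier[OF M, of l]
  have "P \<in> carrier_mat (1 * n) (1 * n)"
    unfolding P using \<Lambda>1 M \<Lambda>2 by (intro mult_carrier_mat)
  then have Pn: "P \<in> carrier_mat n n" by simp
  have EP: "eval_mat_poly P \<mu> = (transpose_mat (hom_Lambda 1 (\<mu> ^ l) eta) \<otimes>\<^sub>K 1\<^sub>m n) * ?E M
      * (hom_Lambda 1 (\<mu> ^ l) eps \<otimes>\<^sub>K 1\<^sub>m n)"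
    unfolding P eval_mat_poly_mult[OF mult_carrier_mat[OF \<Lambda>1 M] \<Lambda>2] eval_mat_poly_mult[OF \<Lambda>1 M]
    unfolding eval_mat_poly_def
    by (simp add: map_mat_kronecker_one map_mat_transpose eval_subst_power_Lambda_col)
  have "?E M \<in> carrier_mat ((eta + 1) * n) ((eps + 1) * n)" using M by simp
  note null = hom_block_kronecker_null_vector[OF this, of z 1 "\<mu> ^ l" eps]
  have "?E (block_kronecker l eps n eta n M) *\<^sub>v z = 0\<^sub>v ((eta + 1) * n + eps * n)"
    using z dims by (simp add: right_eigenvector_def eval_mat_poly_def)
  moreover have "z \<in> carrier_vec ((eps + 1) * n + eta * n)" "z \<noteq> 0\<^sub>v ((eps + 1) * n + eta * n)"
    using z dims by (simp_all add: right_eigenvector_def)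
  ultimately show ?thesis
    using null Pn unfolding right_eigenvector_def EP map_block_kronecker[OF M, where f = "\<lambda>p. poly p \<mu>", OF poly_0] eval_subst_power_L_pencil
    by (simp add: vec_block_def)
qed

lemma recover_right_eigenvector_inf:
  assumes M: "M \<in> carrier_mat ((eta + 1) * n) ((eps + 1) * n)" and gr: "has_grade l M" and l: "l \<ge> 1"
    and P: "P = (transpose_mat (subst_power l (Lambda_col eta)) \<otimes>\<^sub>K 1\<^sub>m n) * M
             * (subst_power l (Lambda_col eps) \<otimes>\<^sub>K 1\<^sub>m n)"
    and z: "right_eigenvector_inf l (block_kronecker l eps n eta n M) z"
  shows "right_eigenvector_inf ((eps + eta + 1) * l) P (vec_block n 0 z)"
proof -
  let ?\<Lambda>1 = "transpose_mat (subst_power l (Lambda_col eta)) \<otimes>\<^sub>K 1\<^sub>m n"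
  let ?\<Lambda>2 = "subst_power l (Lambda_col eps) \<otimes>\<^sub>K 1\<^sub>m n"
  let ?E = "map_mat (\<lambda>p. coeff p l)"
  have \<Lambda>1: "?\<Lambda>1 \<in> carrier_mat (1 * n) ((eta + 1) * n)"
    and \<Lambda>2: "?\<Lambda>2 \<in> carrier_mat ((eps + 1) * n) (1 * n)"
    by (rule kronecker_one_carrier, simp)+
  have gr1: "has_grade (eta * l) ?\<Lambda>1" and gr2: "has_grade (eps * l) ?\<Lambda>2"
    by (simp_all add: has_grade_kronecker_one has_grade_Lambda_col)
  note dims = block_kronecker_carrier[OF M, of l]
  have "P \<in> carrier_mat (1 * n) (1 * n)"
    unfolding P using \<Lambda>1 M \<Lambda>2 by (intro mult_carrier_mat)
  then have Pn: "P \<in> carrier_mat n n" by simp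
  have d: "(eps + eta + 1) * l = eta * l + l + eps * l" by (simp add: algebra_simps)
  have EP: "coeff_mat ((eps + eta + 1) * l) P = (transpose_mat (hom_Lambda 0 1 eta) \<otimes>\<^sub>K 1\<^sub>m n) * ?E M
      * (hom_Lambda 0 1 eps \<otimes>\<^sub>K 1\<^sub>m n)"
    unfolding P d coeff_mat_mult[OF mult_carrier_mat[OF \<Lambda>1 M] \<Lambda>2 has_grade_mult[OF \<Lambda>1 M gr1 gr] gr2]
      coeff_mat_mult[OF \<Lambda>1 M gr1 gr]
    unfolding coeff_mat_def
    using l by (simp add: map_mat_kronecker_one map_mat_transpose coeff_subst_power_Lambda_col)
  have "?E M \<in> carrier_mat ((eta + 1) * n) ((eps + 1) * n)" using M by simp
  note null = hom_block_kronecker_null_vector[OF this, of z 0 1 0]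
  have rev_dim: "dim_row (rev_mat_poly g Q) = dim_row Q" "dim_col (rev_mat_poly g Q) = dim_col Q"
    for g and Q :: "'a poly mat"
    by (simp_all add: rev_mat_poly_def)
  have "?E (block_kronecker l eps n eta n M) *\<^sub>v z = 0\<^sub>v ((eta + 1) * n + eps * n)"
    using z dims
    by (simp add: right_eigenvector_inf_def right_eigenvector_def eval_rev_mat_poly_0 rev_dim coeff_mat_def)
  moreover have "z \<in> carrier_vec ((eps + 1) * n + eta * n)" "z \<noteq> 0\<^sub>v ((eps + 1) * n + eta * n)"
    using z dims by (simp_all add: right_eigenvector_inf_def right_eigenvector_def rev_dim)
  ultimately show ?thesis
    using null Pn
    unfolding right_eigenvector_inf_def right_eigenvector_def eval_rev_mat_poly_0 rev_dim EP
      map_block_kronecker[OF M, where f = "\<lambda>p. coeff p l", OF coeff_0] coeff_subst_power_L_pencil[OF l]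
    by (simp add: vec_block_def)
qed

section \<open>Transposition and left eigenvectors\<close>

lemma left_eigenvector_iff_transpose:
  "left_eigenvector P \<mu> y \<longleftrightarrow> right_eigenvector (transpose_mat P) \<mu> y"
proof -
  let ?E = "eval_mat_poly P \<mu>"
  have "mat_of_row y * ?E = 0\<^sub>m 1 (dim_col P) \<longleftrightarrow> transpose_mat ?E *\<^sub>v y = 0\<^sub>v (dim_col P)"
    if y: "y \<in> carrier_vec (dim_row P)"
  proof -
    have "(mat_of_row y * ?E) $$ (0, j) = (transpose_mat ?E *\<^sub>v y) $ j" if "j < dim_col P" for j
      using that y by (simp add: eval_mat_poly_def comm_scalar_prod[of _ "dim_row P"])
    then show ?thesis
      by (auto simp: mat_eq_iff vec_eq_iff eval_mat_poly_def simp del: index_mult_mat(1) index_mult_mat_vec)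
  qed
  then show ?thesis
    by (auto simp: left_eigenvector_def right_eigenvector_def eval_mat_poly_def map_mat_transpose)
qed

lemma left_eigenvector_inf_iff_transpose:
  "left_eigenvector_inf g P y \<longleftrightarrow> right_eigenvector_inf g (transpose_mat P) y"
  by (simp add: left_eigenvector_inf_def right_eigenvector_inf_def left_eigenvector_iff_transpose
      rev_mat_poly_def map_mat_transpose)

text \<open>
  Transposition exchanges the two pencils, so block Kronecker matrix polynomials are closed under
  it; together with \<open>transpose_block_form\<close> this reduces left eigenvectors to right ones.
\<close>

lemma transpose_block_kronecker:
  assumes M: "M \<in> carrier_mat ((eta + 1) * m) ((eps + 1) * n)"
  shows "transpose_mat (block_kronecker l eps n eta m M) = block_kronecker l eta m eps n (transpose_mat M)"
proof -
  have blocks: "transpose_mat (subst_power l (L_pencil eta)) \<otimes>\<^sub>K 1\<^sub>m m \<in> carrier_mat ((eta + 1) * m) (eta * m)"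
    "subst_power l (L_pencil eps) \<otimes>\<^sub>K 1\<^sub>m n \<in> carrier_mat (eps * n) ((eps + 1) * n)"
    by (rule kronecker_one_carrier, simp)+
  show ?thesis
    unfolding block_kronecker_def transpose_four_block_mat[OF M blocks zero_carrier_mat]
    by (simp add: transpose_kronecker_one)
qed

lemma transpose_block_form:
  assumes M: "M \<in> carrier_mat ((eta + 1) * m) ((eps + 1) * n)"
  shows "transpose_mat ((transpose_mat (subst_power l (Lambda_col eta)) \<otimes>\<^sub>K 1\<^sub>m m) * M
             * (subst_power l (Lambda_col eps) \<otimes>\<^sub>K 1\<^sub>m n))
    = (transpose_mat (subst_power l (Lambda_col eps)) \<otimes>\<^sub>K 1\<^sub>m n) * transpose_mat M
             * (subst_power l (Lambda_col eta) \<otimes>\<^sub>K 1\<^sub>m m)"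
proof -
  let ?\<Lambda>1 = "transpose_mat (subst_power l (Lambda_col eta)) \<otimes>\<^sub>K 1\<^sub>m m"
  let ?\<Lambda>2 = "subst_power l (Lambda_col eps) \<otimes>\<^sub>K 1\<^sub>m n"
  have \<Lambda>1: "?\<Lambda>1 \<in> carrier_mat (1 * m) ((eta + 1) * m)"
    and \<Lambda>2: "?\<Lambda>2 \<in> carrier_mat ((eps + 1) * n) (1 * n)"
    by (rule kronecker_one_carrier, simp)+
  have "transpose_mat (?\<Lambda>1 * M * ?\<Lambda>2) = transpose_mat ?\<Lambda>2 * (transpose_mat M * transpose_mat ?\<Lambda>1)"
    unfolding transpose_mult[OF mult_carrier_mat[OF \<Lambda>1 M] \<Lambda>2] transpose_mult[OF \<Lambda>1 M] ..
  also have "\<dots> = transpose_mat ?\<Lambda>2 * transpose_mat M * transpose_mat ?\<Lambda>1"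
    using \<Lambda>1 \<Lambda>2 M by (intro assoc_mult_mat[symmetric]) auto
  finally show ?thesis by (simp add: transpose_kronecker_one)
qed

section \<open>Recovery of all eigenvectors\<close>

theorem theorem6p9:
  fixes P M \<L> :: "'a::field poly mat" and n d k l eps eta :: nat
  assumes "P \<in> carrier_mat n n" and "has_grade d P" and "regular_mat_poly P"
    and "l \<ge> 1" and "d = k * l"
    and "M \<in> carrier_mat ((eta + 1) * n) ((eps + 1) * n)" and "has_grade l M"
    and "\<L> = block_kronecker l eps n eta n M"
    and "k = eps + eta + 1"
    and "P = (transpose_mat (subst_power l (Lambda_col eta)) \<otimes>\<^sub>K 1\<^sub>m n) * M
             * (subst_power l (Lambda_col eps) \<otimes>\<^sub>K 1\<^sub>m n)"
  shows "(\<forall>z \<in> carrier_vec (n * k). \<forall>\<mu>.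
            right_eigenvector \<L> \<mu> z \<longrightarrow> right_eigenvector P \<mu> (vec_block n eps z))
       \<and> (\<forall>z \<in> carrier_vec (n * k).
            right_eigenvector_inf l \<L> z \<longrightarrow> right_eigenvector_inf d P (vec_block n 0 z))
       \<and> (\<forall>w \<in> carrier_vec (n * k). \<forall>\<mu>.
            left_eigenvector \<L> \<mu> w \<longrightarrow> left_eigenvector P \<mu> (vec_block n eta w))
       \<and> (\<forall>w \<in> carrier_vec (n * k).
            left_eigenvector_inf l \<L> w \<longrightarrow> left_eigenvector_inf d P (vec_block n 0 w))"

proof -
  note M = assms(6) and gr = assms(7) and P = assms(10)
  have MT: "transpose_mat M \<in> carrier_mat ((eps + 1) * n) ((eta + 1) * n)" using M by simp
  have grT: "has_grade l (transpose_mat M)" using gr by simp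
  note PT = transpose_block_form[OF M, of l, folded P]
  have d: "d = (eps + eta + 1) * l" "d = (eta + eps + 1) * l"
    using assms(5,9) by (simp_all add: add.commute)
  show ?thesis
    unfolding assms(8) left_eigenvector_iff_transpose left_eigenvector_inf_iff_transpose
      transpose_block_kronecker[OF M]
    using recover_right_eigenvector[OF M P] recover_right_eigenvector[OF MT PT]
      recover_right_eigenvector_inf[OF M gr assms(4) P]
      recover_right_eigenvector_inf[OF MT grT assms(4) PT]
    by (auto simp: d(1) simp: add.commute)
qed

end
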